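(* Let $X$ be a metric space and $\Omega_1,\Omega_2,U\subset X$ with $\Omega_1\cap\Omega_2\cap U\ne\emptyset$. The pair of indicator functions $(i_{\Omega_1},i_{\Omega_2})$ is (i) firmly uniformly lower semicontinuous on $U$ if and only if $$\limsup_{\operatorname{dist}(x,\Omega_1\cap U)\to0,\ \operatorname{dist}(x,\Omega_2\cap U)\to0,\ x\in U}\operatorname{dist}(x,\Omega_1\cap\Omega_2\cap U)=0;$$ (ii) firmly quasiuniformly lower semicontinuous on $U$ if and only if $$\sup_{V\in EI(U)}\ \limsup_{\operatorname{dist}(x,\Omega_1)\to0,\ \operatorname{dist}(x,\Omega_2)\to0,\ x\in V}\operatorname{dist}(x,\Omega_1\cap\Omega_2)=0;$$ (iii) firmly quasiuniformly lower semicontinuous near a point $\bar x\in\Omega_1\cap\Omega_2$ if and only if for some $\delta>0$ it holds $$\limsup_{\operatorname{dist}(x,\Omega_1)\to0,\ \operatorname{dist}(x,\Omega_2)\to0,\ x\in B_\delta(\bar x)}\operatorname{dist}(x,\Omega_1\cap\Omega_2)=0.$$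
   Context: $i_\Omega(x)=0$ if $x\in\Omega$ and $i_\Omega(x)=+\infty$ otherwise; $B_\delta$, $\overline B_\delta$ are open and closed balls; $\operatorname{dom}\varphi:=\{x\mid\varphi(x)<+\infty\}$. A set $V\subset X$ is an essentially interior subset of $U$ if $\bigcup_{x\in V}B_\rho(x)\subset U$ for some $\rho>0$; $EI(U)$ is the collection of all such $V$. For $\varphi_1,\varphi_2\colon X\to\mathbb{R}\cup\{+\infty\}$, $x_1\in\operatorname{dom}\varphi_1$, $x_2\in\operatorname{dom}\varphi_2$ put $$(\varphi_1\diamondsuit\varphi_2)_U(x_1,x_2):=\inf_{x\in U}\max\{d(x,x_1),\,d(x,x_2),\,(\varphi_1+\varphi_2)(x)-\varphi_1(x_1)-\varphi_2(x_2)\},$$ $$\Theta_U^\circ(\varphi_1,\varphi_2):=\limsup_{\substack{d(x_1,x_2)\to0\\ x_1\in\operatorname{dom}\varphi_1\cap U,\,x_2\in\operatorname{dom}\varphi_2\cap U}}(\varphi_1\diamondsuit\varphi_2)_U(x_1,x_2),\quad \Theta_U^\dagger(\varphi_1,\varphi_2):=\sup_{V\in EI(U)}\ \limsup_{\substack{d(x_1,x_2)\to0\\ x_1\in\operatorname{dom}\varphi_1\cap V,\,x_2\in\operatorname{dom}\varphi_2\cap V}}(\varphi_1\diamondsuit\varphi_2)_U(x_1,x_2).$$ Every limsup here and in the claim means $\lim_{\eta\downarrow0}$ of the supremum over the indicated points for which the quantities tending to $0$ are $<\eta$; the supremum of a nonnegative quantity over an empty set is $0$. The pair is firmly uniformly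 (resp. firmly quasiuniformly) lower semicontinuous on $U$ if $\Theta_U^\circ(\varphi_1,\varphi_2)=0$ (resp. $\Theta_U^\dagger(\varphi_1,\varphi_2)=0$); it is firmly quasiuniformly lower semicontinuous near $\bar x\in\operatorname{dom}\varphi_1\cap\operatorname{dom}\varphi_2$ if it is so on $\overline B_\delta(\bar x)$ for all sufficiently small $\delta>0$. *)

theory Defs
  imports "HOL-Analysis.Analysis"
begin

text \<open>
  Functions with values in the reals extended by \<open>+\<infinity>\<close> are represented by \<^typ>\<open>ereal\<close>-valued
  functions; the value \<open>-\<infinity>\<close> is not intended to occur.
\<close>

definition ind_fun :: "'a set \<Rightarrow> 'a \<Rightarrow> ereal" where
  "ind_fun \<Omega> x = (if x \<in> \<Omega> then 0 else \<infinity>)"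

definition dom_fun :: "('a \<Rightarrow> ereal) \<Rightarrow> 'a set" where
  "dom_fun \<phi> = {x. \<phi> x < \<infinity>}"

definition ess_interior :: "'a::metric_space set \<Rightarrow> 'a set set" where
  "ess_interior U = {V. \<exists>\<rho>>0. (\<Union>x\<in>V. ball x \<rho>) \<subseteq> U}"

text \<open>
  The upper limit of a nonnegative \<open>f\<close> over the points of \<open>A\<close> at which all the quantities in \<open>Q\<close>
  tend to 0. Inserting 0 makes the supremum over an empty set equal to 0 (in \<^typ>\<open>ereal\<close> it would
  be \<open>-\<infinity>\<close>) and changes nothing otherwise. The limit always exists, see \<open>limsup_to_0_tendsto\<close>.
\<close>

definition sup_below :: "('b \<Rightarrow> real) set \<Rightarrow> 'b set \<Rightarrow> ('b \<Rightarrow> ereal) \<Rightarrow> real \<Rightarrow> ereal" where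
  "sup_below Q A f \<eta> = Sup (insert 0 (f ` {p \<in> A. \<forall>q\<in>Q. q p < \<eta>}))"

definition limsup_to_0 :: "('b \<Rightarrow> real) set \<Rightarrow> 'b set \<Rightarrow> ('b \<Rightarrow> ereal) \<Rightarrow> ereal" where
  "limsup_to_0 Q A f = Lim (at_right 0) (sup_below Q A f)"

lemma sup_below_mono: "\<eta> \<le> \<eta>' \<Longrightarrow> sup_below Q A f \<eta> \<le> sup_below Q A f \<eta>'"
  unfolding sup_below_def by (rule Sup_subset_mono) (auto intro: less_le_trans)

lemma sup_below_tendsto_INF:
  "(sup_below Q A f \<longlongrightarrow> (INF \<eta>\<in>{0<..}. sup_below Q A f \<eta>)) (at_right 0)"
proof (rule order_tendstoI)
  fix a assume "a < (INF \<eta>\<in>{0<..}. sup_below Q A f \<eta>)"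
  then have "a < sup_below Q A f \<eta>" if "\<eta> > 0" for \<eta>
    using that by (meson INF_lower greaterThan_iff less_le_trans)
  then show "\<forall>\<^sub>F \<eta> in at_right 0. a < sup_below Q A f \<eta>"
    by (auto simp: eventually_at_right_field intro: exI[of _ 1])
next
  fix a assume "(INF \<eta>\<in>{0<..}. sup_below Q A f \<eta>) < a"
  then obtain \<eta>0 where *: "\<eta>0 > 0" "sup_below Q A f \<eta>0 < a"
    by (auto simp: INF_less_iff)
  have "\<forall>\<^sub>F \<eta> in at_right 0. \<eta> < \<eta>0"
    using *(1) by (auto simp: eventually_at_right_field)
  then show "\<forall>\<^sub>F \<eta> in at_right 0. sup_below Q A f \<eta> < a"
  proof (rule eventually_mono)
    fix \<eta> assume "\<eta> < \<eta>0"
    then have "sup_below Q A f \<eta> \<le> sup_below Q A f \<eta>0"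
      by (intro sup_below_mono) simp
    then show "sup_below Q A f \<eta> < a"
      using *(2) by (rule le_less_trans)
  qed
qed

lemma limsup_to_0_eq_INF: "limsup_to_0 Q A f = (INF \<eta>\<in>{0<..}. sup_below Q A f \<eta>)"
  unfolding limsup_to_0_def by (rule tendsto_Lim[OF _ sup_below_tendsto_INF]) simp

lemma limsup_to_0_tendsto: "(sup_below Q A f \<longlongrightarrow> limsup_to_0 Q A f) (at_right 0)"
  unfolding limsup_to_0_eq_INF by (rule sup_below_tendsto_INF)

definition diamond ::
  "'a::metric_space set \<Rightarrow> ('a \<Rightarrow> ereal) \<Rightarrow> ('a \<Rightarrow> ereal) \<Rightarrow> 'a \<Rightarrow> 'a \<Rightarrow> ereal" where
  "diamond U \<phi>1 \<phi>2 x1 x2 =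
     (INF x\<in>U. max (max (ereal (dist x x1)) (ereal (dist x x2)))
                   (\<phi>1 x + \<phi>2 x - \<phi>1 x1 - \<phi>2 x2))"

definition diamond_limsup ::
  "'a::metric_space set \<Rightarrow> 'a set \<Rightarrow> ('a \<Rightarrow> ereal) \<Rightarrow> ('a \<Rightarrow> ereal) \<Rightarrow> ereal" where
  "diamond_limsup V U \<phi>1 \<phi>2 =
     limsup_to_0 {\<lambda>(x1, x2). dist x1 x2} ((dom_fun \<phi>1 \<inter> V) \<times> (dom_fun \<phi>2 \<inter> V))
       (\<lambda>(x1, x2). diamond U \<phi>1 \<phi>2 x1 x2)"

definition Theta_circ ::
  "'a::metric_space set \<Rightarrow> ('a \<Rightarrow> ereal) \<Rightarrow> ('a \<Rightarrow> ereal) \<Rightarrow> ereal" where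
  "Theta_circ U \<phi>1 \<phi>2 = diamond_limsup U U \<phi>1 \<phi>2"

definition Theta_dagger ::
  "'a::metric_space set \<Rightarrow> ('a \<Rightarrow> ereal) \<Rightarrow> ('a \<Rightarrow> ereal) \<Rightarrow> ereal" where
  "Theta_dagger U \<phi>1 \<phi>2 = (SUP V\<in>ess_interior U. diamond_limsup V U \<phi>1 \<phi>2)"

definition firmly_uniformly_lsc_on ::
  "'a::metric_space set \<Rightarrow> ('a \<Rightarrow> ereal) \<Rightarrow> ('a \<Rightarrow> ereal) \<Rightarrow> bool" where
  "firmly_uniformly_lsc_on U \<phi>1 \<phi>2 \<longleftrightarrow> Theta_circ U \<phi>1 \<phi>2 = 0"

definition firmly_quasiuniformly_lsc_on ::
  "'a::metric_space set \<Rightarrow> ('a \<Rightarrow> ereal) \<Rightarrow> ('a \<Rightarrow> ereal) \<Rightarrow> bool" where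
  "firmly_quasiuniformly_lsc_on U \<phi>1 \<phi>2 \<longleftrightarrow> Theta_dagger U \<phi>1 \<phi>2 = 0"

text \<open>Meant for \<open>xbar \<in> dom_fun \<phi>1 \<inter> dom_fun \<phi>2\<close>.\<close>

definition firmly_quasiuniformly_lsc_near ::
  "'a::metric_space \<Rightarrow> ('a \<Rightarrow> ereal) \<Rightarrow> ('a \<Rightarrow> ereal) \<Rightarrow> bool" where
  "firmly_quasiuniformly_lsc_near xbar \<phi>1 \<phi>2 \<longleftrightarrow>
     (\<forall>\<^sub>F \<delta> in at_right 0. firmly_quasiuniformly_lsc_on (cball xbar \<delta>) \<phi>1 \<phi>2)"

text \<open>
  The distance to a set is the library's \<^const>\<open>infdist\<close>, whose value for the empty set is 0 rather
  than \<open>+\<infinity>\<close>; it should only be used with nonempty sets.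
\<close>

end

theory Submission
  imports Defs
begin

text \<open>
  On \<open>\<Omega>1 \<times> \<Omega>2\<close> the indicator functions contribute nothing to the diamond but the constraint
  \<open>x \<in> \<Omega>1 \<inter> \<Omega>2\<close>, so a vanishing \<open>diamond_limsup\<close> says that two sufficiently close points, one of
  each set, have a point of \<open>\<Omega>1 \<inter> \<Omega>2 \<inter> U\<close> close to both
  (\<open>diamond_limsup_ind_fun_eq_0_iff\<close>). The distance condition says that a point close to both
  sets is close to their intersection. They are translated into one another as follows.

  A point \<open>x\<close> close to both sets has neighbours \<open>x1 \<in> \<Omega>1\<close>, \<open>x2 \<in> \<Omega>2\<close>, which are then close to each
  other; a common point close to these two is close to \<open>x\<close>. Conversely, if \<open>x1 \<in> \<Omega>1\<close> and
  \<open>x2 \<in> \<Omega>2\<close> are close to each other, then \<open>x1\<close> itself is close to both sets, and a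
  common point close to \<open>x1\<close> is close to \<open>x2\<close> as well.

  The only remaining question is whether the neighbours found in this way lie in the region where
  they are needed. In the uniform case all sets are intersected with \<open>U\<close> beforehand. In the
  quasiuniform case it is settled by the margin \<open>\<rho>\<close> of an essentially interior set \<open>V\<close>: the points
  \<open>x1\<close> and \<open>x2\<close> may leave \<open>V\<close>, but not its enlargement by \<open>\<rho>/2\<close>, which is still essentially
  interior, and the common point may leave \<open>V\<close>, but not \<open>U\<close>. Both cases are instances of
  \<open>infdist_limsup_eq_0I\<close> and \<open>diamond_limsup_eq_0I\<close>. The statement near a point follows from the
  quasiuniform one because smaller balls are essentially interior to larger closed balls, while
  the essentially interior subsets of a smaller closed ball are contained in a larger open ball.
\<close>

section \<open>Vanishing upper limits\<close>

lemma limsup_to_0_nonneg: "0 \<le> limsup_to_0 Q A f"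
  unfolding limsup_to_0_eq_INF sup_below_def by (intro INF_greatest Sup_upper) simp

lemma limsup_to_0_eq_0_iff:
  "limsup_to_0 Q A f = 0 \<longleftrightarrow>
     (\<forall>\<epsilon>>0. \<exists>\<eta>>0. \<forall>p\<in>A. (\<forall>q\<in>Q. q p < \<eta>) \<longrightarrow> f p < ereal \<epsilon>)"
proof
  assume 0: "limsup_to_0 Q A f = 0"
  show "\<forall>\<epsilon>>0. \<exists>\<eta>>0. \<forall>p\<in>A. (\<forall>q\<in>Q. q p < \<eta>) \<longrightarrow> f p < ereal \<epsilon>"
  proof (intro allI impI)
    fix \<epsilon> :: real assume "\<epsilon> > 0"
    then have "(INF \<eta>\<in>{0<..}. sup_below Q A f \<eta>) < ereal \<epsilon>"
      using 0 by (simp add: limsup_to_0_eq_INF)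
    then obtain \<eta> where "\<eta> > 0" and less: "sup_below Q A f \<eta> < ereal \<epsilon>"
      by (auto simp: INF_less_iff)
    have "f p < ereal \<epsilon>" if "p \<in> A" "\<forall>q\<in>Q. q p < \<eta>" for p
    proof -
      have "f p \<le> sup_below Q A f \<eta>"
        unfolding sup_below_def using that by (intro Sup_upper) auto
      then show ?thesis using less by (rule le_less_trans)
    qed
    with \<open>\<eta> > 0\<close> show "\<exists>\<eta>>0. \<forall>p\<in>A. (\<forall>q\<in>Q. q p < \<eta>) \<longrightarrow> f p < ereal \<epsilon>" by blast
  qed
next
  assume *: "\<forall>\<epsilon>>0. \<exists>\<eta>>0. \<forall>p\<in>A. (\<forall>q\<in>Q. q p < \<eta>) \<longrightarrow> f p < ereal \<epsilon>"
  have "limsup_to_0 Q A f \<le> 0 + ereal \<epsilon>" if "\<epsilon> > 0" for \<epsilon>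
  proof -
    from * that obtain \<eta> where "\<eta> > 0"
      and \<eta>: "\<And>p. p \<in> A \<Longrightarrow> \<forall>q\<in>Q. q p < \<eta> \<Longrightarrow> f p < ereal \<epsilon>" by blast
    have "limsup_to_0 Q A f \<le> sup_below Q A f \<eta>"
      unfolding limsup_to_0_eq_INF using \<open>\<eta> > 0\<close> by (intro INF_lower) simp
    also have "\<dots> \<le> ereal \<epsilon>"
      unfolding sup_below_def using that by (intro Sup_least) (auto dest: \<eta> intro: less_imp_le)
    finally show ?thesis by simp
  qed
  then have "limsup_to_0 Q A f \<le> 0" by (simp add: ereal_le_epsilon2)
  then show "limsup_to_0 Q A f = 0" by (intro antisym limsup_to_0_nonneg)
qed

lemma limsup_to_0_eq_0_subset:
  assumes "limsup_to_0 Q A f = 0" "B \<subseteq> A"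
  shows "limsup_to_0 Q B f = 0"
  unfolding limsup_to_0_eq_0_iff
proof (intro allI impI)
  fix \<epsilon> :: real assume "\<epsilon> > 0"
  then obtain \<eta> where "\<eta> > 0" "\<forall>p\<in>A. (\<forall>q\<in>Q. q p < \<eta>) \<longrightarrow> f p < ereal \<epsilon>"
    using assms(1)[unfolded limsup_to_0_eq_0_iff] by blast
  with assms(2) show "\<exists>\<eta>>0. \<forall>p\<in>B. (\<forall>q\<in>Q. q p < \<eta>) \<longrightarrow> f p < ereal \<epsilon>" by blast
qed

lemma infdist_limsup_eq_0_iff:
  "limsup_to_0 {\<lambda>x. infdist x A, \<lambda>x. infdist x B} V (\<lambda>x. ereal (infdist x C)) = 0 \<longleftrightarrow>
     (\<forall>\<epsilon>>0. \<exists>\<eta>>0. \<forall>x\<in>V. infdist x A < \<eta> \<and> infdist x B < \<eta> \<longrightarrow> infdist x C < \<epsilon>)"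
  unfolding limsup_to_0_eq_0_iff by simp

section \<open>The diamond of two indicator functions\<close>

lemma dom_fun_ind_fun [simp]: "dom_fun (ind_fun \<Omega>) = \<Omega>"
  by (auto simp: dom_fun_def ind_fun_def)

lemma diamond_ind_fun_less_iff:
  assumes "x1 \<in> \<Omega>1" "x2 \<in> \<Omega>2" "\<epsilon> > 0"
  shows "diamond U (ind_fun \<Omega>1) (ind_fun \<Omega>2) x1 x2 < ereal \<epsilon> \<longleftrightarrow>
           (\<exists>x\<in>\<Omega>1 \<inter> \<Omega>2 \<inter> U. dist x x1 < \<epsilon> \<and> dist x x2 < \<epsilon>)"
  using assms by (auto simp: diamond_def INF_less_iff ind_fun_def split: if_splits)

lemma diamond_limsup_ind_fun_eq_0_iff:
  "diamond_limsup V U (ind_fun \<Omega>1) (ind_fun \<Omega>2) = 0 \<longleftrightarrow>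
     (\<forall>\<epsilon>>0. \<exists>\<eta>>0. \<forall>x1\<in>\<Omega>1 \<inter> V. \<forall>x2\<in>\<Omega>2 \<inter> V. dist x1 x2 < \<eta> \<longrightarrow>
        (\<exists>x\<in>\<Omega>1 \<inter> \<Omega>2 \<inter> U. dist x x1 < \<epsilon> \<and> dist x x2 < \<epsilon>))"
proof -
  have "(\<forall>p\<in>(\<Omega>1 \<inter> V) \<times> (\<Omega>2 \<inter> V). (\<forall>q\<in>{\<lambda>(x1, x2). dist x1 x2}. q p < \<eta>) \<longrightarrow>
          (case p of (x1, x2) \<Rightarrow> diamond U (ind_fun \<Omega>1) (ind_fun \<Omega>2) x1 x2) < ereal \<epsilon>) \<longleftrightarrow>
        (\<forall>x1\<in>\<Omega>1 \<inter> V. \<forall>x2\<in>\<Omega>2 \<inter> V. dist x1 x2 < \<eta> \<longrightarrow>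
          (\<exists>x\<in>\<Omega>1 \<inter> \<Omega>2 \<inter> U. dist x x1 < \<epsilon> \<and> dist x x2 < \<epsilon>))" if "\<epsilon> > 0" for \<epsilon> \<eta> :: real
    using diamond_ind_fun_less_iff[OF _ _ that, of _ \<Omega>1 _ \<Omega>2 U] by auto
  then show ?thesis
    unfolding diamond_limsup_def limsup_to_0_eq_0_iff dom_fun_ind_fun by (simp cong: imp_cong)
qed

section \<open>Common points versus the distance to the intersection\<close>

lemma infdist_lessE:
  assumes "infdist x A < e" "A \<noteq> {}"
  obtains a where "a \<in> A" "dist x a < e"
  using assms by (auto simp: infdist_def cINF_less_iff)

text \<open>
  The sets \<open>A\<close> and \<open>B\<close> stand for \<open>\<Omega>1\<close> and \<open>\<Omega>2\<close> or for their parts in \<open>U\<close>, and \<open>W\<close> for a region that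
  catches all points of \<open>A\<close> and \<open>B\<close> near \<open>V\<close>. If \<open>x1\<close> and \<open>x2\<close> are within \<open>\<eta>\<close> of \<open>x\<close>, they are within
  \<open>2 * \<eta>\<close> of each other, and a common point within \<open>\<epsilon>/2\<close> of \<open>x1\<close> is within \<open>\<epsilon>/2 + \<eta>\<close> of \<open>x\<close>.
\<close>

lemma infdist_limsup_eq_0I:
  assumes diamond: "diamond_limsup W U (ind_fun \<Omega>1) (ind_fun \<Omega>2) = 0"
    and nonempty: "A \<noteq> {}" "B \<noteq> {}"
    and "\<rho> > 0"
    and near: "\<And>x. x \<in> V \<Longrightarrow> A \<inter> ball x \<rho> \<subseteq> \<Omega>1 \<inter> W" "\<And>x. x \<in> V \<Longrightarrow> B \<inter> ball x \<rho> \<subseteq> \<Omega>2 \<inter> W"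
    and C: "\<Omega>1 \<inter> \<Omega>2 \<inter> U \<subseteq> C"
  shows "limsup_to_0 {\<lambda>x. infdist x A, \<lambda>x. infdist x B} V (\<lambda>x. ereal (infdist x C)) = 0"
  unfolding infdist_limsup_eq_0_iff
proof (intro allI impI)
  fix \<epsilon> :: real assume "\<epsilon> > 0"
  then have "\<epsilon>/2 > 0" by simp
  with diamond[unfolded diamond_limsup_ind_fun_eq_0_iff] obtain \<eta>0 where "\<eta>0 > 0"
    and \<eta>0: "\<And>x1 x2. x1 \<in> \<Omega>1 \<inter> W \<Longrightarrow> x2 \<in> \<Omega>2 \<inter> W \<Longrightarrow> dist x1 x2 < \<eta>0 \<Longrightarrow>
               \<exists>y\<in>\<Omega>1 \<inter> \<Omega>2 \<inter> U. dist y x1 < \<epsilon>/2 \<and> dist y x2 < \<epsilon>/2"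
    by blast
  define \<eta> where "\<eta> = min (\<eta>0/2) (min \<rho> (\<epsilon>/2))"
  have "\<eta> > 0" using \<open>\<epsilon> > 0\<close> \<open>\<eta>0 > 0\<close> \<open>\<rho> > 0\<close> by (simp add: \<eta>_def)
  moreover have "infdist x C < \<epsilon>" if "x \<in> V" "infdist x A < \<eta>" "infdist x B < \<eta>" for x
  proof -
    obtain x1 where x1: "x1 \<in> A" "dist x x1 < \<eta>"
      using \<open>infdist x A < \<eta>\<close> nonempty(1) by (rule infdist_lessE)
    obtain x2 where x2: "x2 \<in> B" "dist x x2 < \<eta>"
      using \<open>infdist x B < \<eta>\<close> nonempty(2) by (rule infdist_lessE)
    have "x1 \<in> \<Omega>1 \<inter> W" using near(1)[OF \<open>x \<in> V\<close>] x1 by (auto simp: \<eta>_def)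
    moreover have "x2 \<in> \<Omega>2 \<inter> W" using near(2)[OF \<open>x \<in> V\<close>] x2 by (auto simp: \<eta>_def)
    moreover have "dist x1 x2 < \<eta>0"
      using x1(2) x2(2) dist_triangle3[of x1 x2 x] by (simp add: \<eta>_def)
    ultimately obtain y where y: "y \<in> \<Omega>1 \<inter> \<Omega>2 \<inter> U" "dist y x1 < \<epsilon>/2"
      using \<eta>0 by blast
    have "infdist x C \<le> dist x y" using y(1) C by (intro infdist_le) blast
    also have "\<dots> < \<epsilon>"
      using x1(2) y(2) dist_triangle2[of x y x1] by (simp add: \<eta>_def)
    finally show ?thesis .
  qed
  ultimately show "\<exists>\<eta>>0. \<forall>x\<in>V. infdist x A < \<eta> \<and> infdist x B < \<eta> \<longrightarrow> infdist x C < \<epsilon>"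
    by blast
qed

text \<open>
  The distance condition is applied at \<open>x1\<close>, whose distance to \<open>A\<close> is 0 and to \<open>B\<close> at most
  \<open>dist x1 x2\<close>. The margin \<open>\<rho>\<close> ensures that the nearby point of \<open>C\<close> belongs to \<open>U\<close>.
\<close>

lemma diamond_limsup_eq_0I:
  assumes dist: "limsup_to_0 {\<lambda>x. infdist x A, \<lambda>x. infdist x B} V
                   (\<lambda>x. ereal (infdist x C)) = 0"
    and sub: "\<Omega>1 \<inter> V \<subseteq> A" "\<Omega>2 \<inter> V \<subseteq> B"
    and "C \<noteq> {}"
    and "\<rho> > 0"
    and near: "\<And>x. x \<in> V \<Longrightarrow> C \<inter> ball x \<rho> \<subseteq> \<Omega>1 \<inter> \<Omega>2 \<inter> U"
  shows "diamond_limsup V U (ind_fun \<Omega>1) (ind_fun \<Omega>2) = 0"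
  unfolding diamond_limsup_ind_fun_eq_0_iff
proof (intro allI impI)
  fix \<epsilon> :: real assume "\<epsilon> > 0"
  define \<epsilon>' where "\<epsilon>' = min (\<epsilon>/2) \<rho>"
  have "\<epsilon>' > 0" using \<open>\<epsilon> > 0\<close> \<open>\<rho> > 0\<close> by (simp add: \<epsilon>'_def)
  then obtain \<eta>0 where "\<eta>0 > 0"
    and \<eta>0: "\<And>x. x \<in> V \<Longrightarrow> infdist x A < \<eta>0 \<Longrightarrow> infdist x B < \<eta>0 \<Longrightarrow> infdist x C < \<epsilon>'"
    using dist[unfolded infdist_limsup_eq_0_iff] by meson
  define \<eta> where "\<eta> = min \<eta>0 (\<epsilon>/2)"
  have "\<eta> > 0" using \<open>\<epsilon> > 0\<close> \<open>\<eta>0 > 0\<close> by (simp add: \<eta>_def)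
  moreover have "\<exists>y\<in>\<Omega>1 \<inter> \<Omega>2 \<inter> U. dist y x1 < \<epsilon> \<and> dist y x2 < \<epsilon>"
    if x1: "x1 \<in> \<Omega>1 \<inter> V" and x2: "x2 \<in> \<Omega>2 \<inter> V" and less: "dist x1 x2 < \<eta>" for x1 x2
  proof -
    have "infdist x1 A < \<eta>0" using x1 sub(1) \<open>\<eta>0 > 0\<close> by (subst infdist_zero) auto
    moreover have "infdist x1 B < \<eta>0"
      using infdist_le[of x2 B x1] x2 sub(2) less by (auto simp: \<eta>_def)
    ultimately have "infdist x1 C < \<epsilon>'" using \<eta>0 x1 by blast
    then obtain y where y: "y \<in> C" "dist x1 y < \<epsilon>'"
      using \<open>C \<noteq> {}\<close> by (rule infdist_lessE)
    have "y \<in> \<Omega>1 \<inter> \<Omega>2 \<inter> U" using near[of x1] x1 y by (auto simp: \<epsilon>'_def)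
    moreover have "dist y x1 < \<epsilon>" using y(2) \<open>\<epsilon> > 0\<close> by (simp add: \<epsilon>'_def dist_commute)
    moreover have "dist y x2 < \<epsilon>"
      using y(2) less dist_triangle3[of y x2 x1] by (simp add: \<epsilon>'_def \<eta>_def)
    ultimately show ?thesis by blast
  qed
  ultimately show "\<exists>\<eta>>0. \<forall>x1\<in>\<Omega>1 \<inter> V. \<forall>x2\<in>\<Omega>2 \<inter> V. dist x1 x2 < \<eta> \<longrightarrow>
      (\<exists>x\<in>\<Omega>1 \<inter> \<Omega>2 \<inter> U. dist x x1 < \<epsilon> \<and> dist x x2 < \<epsilon>)"
    by blast
qed

section \<open>Uniform and quasiuniform semicontinuity of indicator functions\<close>

lemma firmly_uniformly_lsc_on_ind_fun_iff:
  assumes "\<Omega>1 \<inter> \<Omega>2 \<inter> U \<noteq> {}"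
  shows "firmly_uniformly_lsc_on U (ind_fun \<Omega>1) (ind_fun \<Omega>2) \<longleftrightarrow>
           limsup_to_0 {\<lambda>x. infdist x (\<Omega>1 \<inter> U), \<lambda>x. infdist x (\<Omega>2 \<inter> U)} U
             (\<lambda>x. ereal (infdist x (\<Omega>1 \<inter> \<Omega>2 \<inter> U))) = 0"
  unfolding firmly_uniformly_lsc_on_def Theta_circ_def
proof
  assume "diamond_limsup U U (ind_fun \<Omega>1) (ind_fun \<Omega>2) = 0"
  then show "limsup_to_0 {\<lambda>x. infdist x (\<Omega>1 \<inter> U), \<lambda>x. infdist x (\<Omega>2 \<inter> U)} U
               (\<lambda>x. ereal (infdist x (\<Omega>1 \<inter> \<Omega>2 \<inter> U))) = 0"
    by (rule infdist_limsup_eq_0I[where \<rho> = 1]) (use assms in auto)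
next
  assume "limsup_to_0 {\<lambda>x. infdist x (\<Omega>1 \<inter> U), \<lambda>x. infdist x (\<Omega>2 \<inter> U)} U
            (\<lambda>x. ereal (infdist x (\<Omega>1 \<inter> \<Omega>2 \<inter> U))) = 0"
  then show "diamond_limsup U U (ind_fun \<Omega>1) (ind_fun \<Omega>2) = 0"
    by (rule diamond_limsup_eq_0I[where \<rho> = 1]) (use assms in auto)
qed

lemma SUP_ess_interior_eq_0_iff:
  fixes F :: "'a::metric_space set \<Rightarrow> ereal"
  assumes "\<And>V. 0 \<le> F V"
  shows "(SUP V\<in>ess_interior U. F V) = 0 \<longleftrightarrow> (\<forall>V\<in>ess_interior U. F V = 0)"
proof -
  have "{} \<in> ess_interior U" by (auto simp: ess_interior_def intro: exI[of _ 1])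
  then have "0 \<le> (SUP V\<in>ess_interior U. F V)"
    using assms by (intro SUP_upper2)
  then have "(SUP V\<in>ess_interior U. F V) = 0 \<longleftrightarrow> (SUP V\<in>ess_interior U. F V) \<le> 0"
    by auto
  also have "\<dots> \<longleftrightarrow> (\<forall>V\<in>ess_interior U. F V = 0)"
    using assms by (auto simp: SUP_le_iff intro: antisym)
  finally show ?thesis .
qed

lemma ess_interior_subset: "V \<in> ess_interior U \<Longrightarrow> V \<subseteq> U"
  by (force simp: ess_interior_def)

lemma ess_interior_enlarge:
  assumes "(\<Union>x\<in>V. ball x (2 * r)) \<subseteq> U" "r > 0"
  shows "(\<Union>x\<in>V. ball x r) \<in> ess_interior U"
proof -
  have "ball y r \<subseteq> ball x (2 * r)" if "y \<in> ball x r" for x y :: 'a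
  proof
    fix z assume "z \<in> ball y r"
    then show "z \<in> ball x (2 * r)" using that dist_triangle[of x z y] by simp
  qed
  then have "(\<Union>y\<in>\<Union>x\<in>V. ball x r. ball y r) \<subseteq> U" using assms(1) by blast
  with \<open>r > 0\<close> show ?thesis by (auto simp: ess_interior_def)
qed

lemma firmly_quasiuniformly_lsc_on_ind_fun_iff:
  assumes "\<Omega>1 \<inter> \<Omega>2 \<noteq> {}"
  shows "firmly_quasiuniformly_lsc_on U (ind_fun \<Omega>1) (ind_fun \<Omega>2) \<longleftrightarrow>
           (\<forall>V\<in>ess_interior U. limsup_to_0 {\<lambda>x. infdist x \<Omega>1, \<lambda>x. infdist x \<Omega>2} V
              (\<lambda>x. ereal (infdist x (\<Omega>1 \<inter> \<Omega>2))) = 0)"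
proof -
  have "firmly_quasiuniformly_lsc_on U (ind_fun \<Omega>1) (ind_fun \<Omega>2) \<longleftrightarrow>
          (\<forall>V\<in>ess_interior U. diamond_limsup V U (ind_fun \<Omega>1) (ind_fun \<Omega>2) = 0)"
    unfolding firmly_quasiuniformly_lsc_on_def Theta_dagger_def
    by (rule SUP_ess_interior_eq_0_iff) (simp add: diamond_limsup_def limsup_to_0_nonneg)
  also have "\<dots> \<longleftrightarrow> (\<forall>V\<in>ess_interior U. limsup_to_0 {\<lambda>x. infdist x \<Omega>1, \<lambda>x. infdist x \<Omega>2} V
              (\<lambda>x. ereal (infdist x (\<Omega>1 \<inter> \<Omega>2))) = 0)" (is "?diamond \<longleftrightarrow> ?dist")
  proof
    assume ?diamond
    show ?dist
    proof
      fix V assume "V \<in> ess_interior U"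
      then obtain \<rho> where \<rho>: "\<rho> > 0" "(\<Union>x\<in>V. ball x \<rho>) \<subseteq> U"
        by (auto simp: ess_interior_def)
      then have "(\<Union>x\<in>V. ball x (\<rho>/2)) \<in> ess_interior U"
        by (intro ess_interior_enlarge) simp_all
      with \<open>?diamond\<close>
      have "diamond_limsup (\<Union>x\<in>V. ball x (\<rho>/2)) U (ind_fun \<Omega>1) (ind_fun \<Omega>2) = 0" by blast
      then show "limsup_to_0 {\<lambda>x. infdist x \<Omega>1, \<lambda>x. infdist x \<Omega>2} V
                   (\<lambda>x. ereal (infdist x (\<Omega>1 \<inter> \<Omega>2))) = 0"
        by (rule infdist_limsup_eq_0I[where \<rho> = "\<rho>/2"]) (use assms \<rho>(1) in auto)
    qed
  next
    assume ?dist
    show ?diamond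
    proof
      fix V assume V: "V \<in> ess_interior U"
      then obtain \<rho> where \<rho>: "\<rho> > 0" "(\<Union>x\<in>V. ball x \<rho>) \<subseteq> U"
        by (auto simp: ess_interior_def)
      from \<open>?dist\<close> V have "limsup_to_0 {\<lambda>x. infdist x \<Omega>1, \<lambda>x. infdist x \<Omega>2} V
                   (\<lambda>x. ereal (infdist x (\<Omega>1 \<inter> \<Omega>2))) = 0" by blast
      then show "diamond_limsup V U (ind_fun \<Omega>1) (ind_fun \<Omega>2) = 0"
        by (rule diamond_limsup_eq_0I[where \<rho> = \<rho>]) (use assms \<rho> in auto)
    qed
  qed
  finally show ?thesis .
qed

lemma ball_in_ess_interior_cball:
  assumes "r < \<delta>"
  shows "ball x r \<in> ess_interior (cball x \<delta>)"
proof -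
  have "ball y (\<delta> - r) \<subseteq> cball x \<delta>" if "y \<in> ball x r" for y
  proof
    fix z assume "z \<in> ball y (\<delta> - r)"
    then show "z \<in> cball x \<delta>" using that dist_triangle[of x z y] by simp
  qed
  then have "(\<Union>y\<in>ball x r. ball y (\<delta> - r)) \<subseteq> cball x \<delta>" by blast
  moreover have "\<delta> - r > 0" using assms by simp
  ultimately show ?thesis unfolding ess_interior_def by blast
qed

lemma firmly_quasiuniformly_lsc_near_ind_fun_iff:
  assumes "\<Omega>1 \<inter> \<Omega>2 \<noteq> {}"
  shows "firmly_quasiuniformly_lsc_near xbar (ind_fun \<Omega>1) (ind_fun \<Omega>2) \<longleftrightarrow>
           (\<exists>\<delta>>0. limsup_to_0 {\<lambda>x. infdist x \<Omega>1, \<lambda>x. infdist x \<Omega>2} (ball xbar \<delta>)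
              (\<lambda>x. ereal (infdist x (\<Omega>1 \<inter> \<Omega>2))) = 0)"
proof -
  let ?L = "\<lambda>V. limsup_to_0 {\<lambda>x. infdist x \<Omega>1, \<lambda>x. infdist x \<Omega>2} V
                  (\<lambda>x. ereal (infdist x (\<Omega>1 \<inter> \<Omega>2)))"
  have "firmly_quasiuniformly_lsc_near xbar (ind_fun \<Omega>1) (ind_fun \<Omega>2) \<longleftrightarrow>
          (\<exists>b>0. \<forall>\<delta>>0. \<delta> < b \<longrightarrow> (\<forall>V\<in>ess_interior (cball xbar \<delta>). ?L V = 0))"
    unfolding firmly_quasiuniformly_lsc_near_def firmly_quasiuniformly_lsc_on_ind_fun_iff[OF assms]
    by (simp add: eventually_at_right_field)
  also have "\<dots> \<longleftrightarrow> (\<exists>\<delta>>0. ?L (ball xbar \<delta>) = 0)"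
  proof
    assume "\<exists>b>0. \<forall>\<delta>>0. \<delta> < b \<longrightarrow> (\<forall>V\<in>ess_interior (cball xbar \<delta>). ?L V = 0)"
    then obtain b where "b > 0"
      and b: "\<And>\<delta> V. 0 < \<delta> \<Longrightarrow> \<delta> < b \<Longrightarrow> V \<in> ess_interior (cball xbar \<delta>) \<Longrightarrow> ?L V = 0" by blast
    have "?L (ball xbar (b/3)) = 0"
      using \<open>b > 0\<close> by (intro b[of "b/2"] ball_in_ess_interior_cball) simp_all
    with \<open>b > 0\<close> show "\<exists>\<delta>>0. ?L (ball xbar \<delta>) = 0" by (intro exI[of _ "b/3"]) simp
  next
    assume "\<exists>\<delta>>0. ?L (ball xbar \<delta>) = 0"
    then obtain b where b: "b > 0" "?L (ball xbar b) = 0" by blast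
    have "?L V = 0" if "\<delta> < b" "V \<in> ess_interior (cball xbar \<delta>)" for \<delta> V
    proof (rule limsup_to_0_eq_0_subset[OF b(2)])
      show "V \<subseteq> ball xbar b" using ess_interior_subset[OF that(2)] that(1) by force
    qed
    with b(1) show "\<exists>b>0. \<forall>\<delta>>0. \<delta> < b \<longrightarrow> (\<forall>V\<in>ess_interior (cball xbar \<delta>). ?L V = 0)"
      by blast
  qed
  finally show ?thesis .
qed

theorem proposition5p13:
  fixes \<Omega>1 \<Omega>2 U :: "'a::metric_space set"
  assumes "\<Omega>1 \<inter> \<Omega>2 \<inter> U \<noteq> {}"
  shows "(firmly_uniformly_lsc_on U (ind_fun \<Omega>1) (ind_fun \<Omega>2) \<longleftrightarrow>
            limsup_to_0 {\<lambda>x. infdist x (\<Omega>1 \<inter> U), \<lambda>x. infdist x (\<Omega>2 \<inter> U)} U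
              (\<lambda>x. ereal (infdist x (\<Omega>1 \<inter> \<Omega>2 \<inter> U))) = 0) \<and>
         (firmly_quasiuniformly_lsc_on U (ind_fun \<Omega>1) (ind_fun \<Omega>2) \<longleftrightarrow>
            (SUP V\<in>ess_interior U.
              limsup_to_0 {\<lambda>x. infdist x \<Omega>1, \<lambda>x. infdist x \<Omega>2} V
                (\<lambda>x. ereal (infdist x (\<Omega>1 \<inter> \<Omega>2)))) = 0) \<and>
         (\<forall>xbar \<in> \<Omega>1 \<inter> \<Omega>2.
            firmly_quasiuniformly_lsc_near xbar (ind_fun \<Omega>1) (ind_fun \<Omega>2) \<longleftrightarrow>
            (\<exists>\<delta>>0. limsup_to_0 {\<lambda>x. infdist x \<Omega>1, \<lambda>x. infdist x \<Omega>2} (ball xbar \<delta>)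
                (\<lambda>x. ereal (infdist x (\<Omega>1 \<inter> \<Omega>2))) = 0))"
proof (intro conjI ballI)
  show "firmly_uniformly_lsc_on U (ind_fun \<Omega>1) (ind_fun \<Omega>2) \<longleftrightarrow>
          limsup_to_0 {\<lambda>x. infdist x (\<Omega>1 \<inter> U), \<lambda>x. infdist x (\<Omega>2 \<inter> U)} U
            (\<lambda>x. ereal (infdist x (\<Omega>1 \<inter> \<Omega>2 \<inter> U))) = 0"
    using assms by (rule firmly_uniformly_lsc_on_ind_fun_iff)
next
  have "\<Omega>1 \<inter> \<Omega>2 \<noteq> {}" using assms by blast
  then show "firmly_quasiuniformly_lsc_on U (ind_fun \<Omega>1) (ind_fun \<Omega>2) \<longleftrightarrow>
          (SUP V\<in>ess_interior U. limsup_to_0 {\<lambda>x. infdist x \<Omega>1, \<lambda>x. infdist x \<Omega>2} V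
             (\<lambda>x. ereal (infdist x (\<Omega>1 \<inter> \<Omega>2)))) = 0"
    by (simp add: firmly_quasiuniformly_lsc_on_ind_fun_iff SUP_ess_interior_eq_0_iff
        limsup_to_0_nonneg)
next
  fix xbar assume "xbar \<in> \<Omega>1 \<inter> \<Omega>2"
  then have "\<Omega>1 \<inter> \<Omega>2 \<noteq> {}" by blast
  then show "firmly_quasiuniformly_lsc_near xbar (ind_fun \<Omega>1) (ind_fun \<Omega>2) \<longleftrightarrow>
          (\<exists>\<delta>>0. limsup_to_0 {\<lambda>x. infdist x \<Omega>1, \<lambda>x. infdist x \<Omega>2} (ball xbar \<delta>)
             (\<lambda>x. ereal (infdist x (\<Omega>1 \<inter> \<Omega>2))) = 0)"
    by (rule firmly_quasiuniformly_lsc_near_ind_fun_iff)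
qed

end
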